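(* The restriction of the class $[\overline{C}_{X^*}]$ to $\Gamma^\pm(2)$ is not trivial; that is, the class of $\overline{C}_{X^*}$ in $H^2(\Gamma^\pm(2),T)$ is nonzero.
   Context: $T=\{z\in\mathbb{C}:|z|=1\}$, $\operatorname{SL}_2^\pm(\mathbb{R})=\{h\in\operatorname{GL}_2(\mathbb{R}):\det h=\pm1\}$, $\Gamma^\pm(2)=\{g\in\operatorname{GL}_2(\mathbb{Z}):\det g=\pm1,\ g\equiv I\bmod 2\}$. $(a,b)_{\mathbb{R}}$ is the real Hilbert symbol: $-1$ if $a<0$ and $b<0$, and $1$ otherwise. For $g=\begin{pmatrix}a&b\\c&d\end{pmatrix}\in\operatorname{SL}_2(\mathbb{R})$ let $x(g)=d\,\mathbb{R}^{\times2}$ if $c=0$, $x(g)=c\,\mathbb{R}^{\times2}$ if $c\ne0$, and $$\overline{c}_{X^*}(g_1,g_2)=(x(g_1),x(g_2))_{\mathbb{R}}\,(-x(g_1)x(g_2),x(g_1g_2))_{\mathbb{R}}.$$ For $y=\pm1$, $g^y=\begin{pmatrix}1&0\\0&y\end{pmatrix}^{-1}g\begin{pmatrix}1&0\\0&y\end{pmatrix}$, and $\nu_2(y,g)=(y,a)_{\mathbb{R}}$ if $c=0$, $\nu_2(y,g)=1$ if $c\neq0$. For $h_1,h_2\in\operatorname{SL}_2^\pm(\mathbb{R})$ write $h_i=\begin{pmatrix}1&0\\0&y_i\end{pmatrix}g_i$ with $y_i=\det h_i$, $g_i\in\operatorname{SL}_2(\mathbb{R})$. Then $\overline{C}_{X^*}(h_1,h_2)=\nu_2(y_2,g_1)\,\overline{c}_{X^*}(g_1^{y_2},g_2)$,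 a $\mu_2$-valued 2-cocycle on $\operatorname{SL}_2^\pm(\mathbb{R})$, regarded as $T$-valued. *)

theory Defs
  imports "HOL-Analysis.Analysis" "HOL-Algebra.Coset" "HOL-Number_Theory.Cong"
begin

section \<open>Second cohomology with trivial coefficients\<close>

text \<open>
  Inhomogeneous cochains of a group \<open>G\<close> with values in an abelian group \<open>A\<close> on which \<open>G\<close> acts
  trivially. Cochains are extensional functions (undefined outside the carrier), so that equality
  of cochains is equality of functions. No normalization is imposed.
\<close>

definition cocycles2 ::
  "('g, 'm) monoid_scheme \<Rightarrow> ('a, 'n) monoid_scheme \<Rightarrow> ('g \<times> 'g \<Rightarrow> 'a) set" where
  "cocycles2 G A =
    {f \<in> carrier G \<times> carrier G \<rightarrow>\<^sub>E carrier A.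
       \<forall>g\<in>carrier G. \<forall>h\<in>carrier G. \<forall>k\<in>carrier G.
         f (g, h) \<otimes>\<^bsub>A\<^esub> f (g \<otimes>\<^bsub>G\<^esub> h, k) = f (h, k) \<otimes>\<^bsub>A\<^esub> f (g, h \<otimes>\<^bsub>G\<^esub> k)}"

definition cocycle_group2 ::
  "('g, 'm) monoid_scheme \<Rightarrow> ('a, 'n) monoid_scheme \<Rightarrow> ('g \<times> 'g \<Rightarrow> 'a) monoid" where
  "cocycle_group2 G A =
    \<lparr>carrier = cocycles2 G A,
     mult = (\<lambda>f f'. \<lambda>p\<in>carrier G \<times> carrier G. f p \<otimes>\<^bsub>A\<^esub> f' p),
     one = (\<lambda>p\<in>carrier G \<times> carrier G. \<one>\<^bsub>A\<^esub>)\<rparr>"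

definition coboundaries2 ::
  "('g, 'm) monoid_scheme \<Rightarrow> ('a, 'n) monoid_scheme \<Rightarrow> ('g \<times> 'g \<Rightarrow> 'a) set" where
  "coboundaries2 G A =
    (\<lambda>\<phi>. \<lambda>(g, h)\<in>carrier G \<times> carrier G. \<phi> g \<otimes>\<^bsub>A\<^esub> \<phi> h \<otimes>\<^bsub>A\<^esub> inv\<^bsub>A\<^esub> \<phi> (g \<otimes>\<^bsub>G\<^esub> h))
      ` (carrier G \<rightarrow>\<^sub>E carrier A)"

definition cohomology2 ::
  "('g, 'm) monoid_scheme \<Rightarrow> ('a, 'n) monoid_scheme \<Rightarrow> ('g \<times> 'g \<Rightarrow> 'a) set monoid" where
  "cohomology2 G A = cocycle_group2 G A Mod coboundaries2 G A"

text \<open>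
  The class of the restriction to \<open>G\<close> of a function \<open>f\<close> of two variables. It is an element of
  \<open>carrier (cohomology2 G A)\<close> only if that restriction is a 2-cocycle.
\<close>

definition cohomology_class2 ::
  "('g, 'm) monoid_scheme \<Rightarrow> ('a, 'n) monoid_scheme \<Rightarrow> ('g \<Rightarrow> 'g \<Rightarrow> 'a) \<Rightarrow> ('g \<times> 'g \<Rightarrow> 'a) set" where
  "cohomology_class2 G A f =
    coboundaries2 G A #>\<^bsub>cocycle_group2 G A\<^esub> (\<lambda>(g, h)\<in>carrier G \<times> carrier G. f g h)"


section \<open>The groups\<close>

definition circle_group :: "complex monoid" where
  "circle_group = \<lparr>carrier = {z. cmod z = 1}, mult = (*), one = 1\<rparr>"

definition SL2pm :: "(real^2^2) monoid" where
  "SL2pm = \<lparr>carrier = {h. det h = 1 \<or> det h = -1}, mult = (**), one = mat 1\<rparr>"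

text \<open>Integral matrices are embedded into the real ones.\<close>

definition Gamma2pm :: "(real^2^2) monoid" where
  "Gamma2pm = SL2pm\<lparr>carrier :=
     map_matrix real_of_int `
       {g :: int^2^2. (det g = 1 \<or> det g = -1) \<and>
                      (\<forall>i j. [g $ i $ j = mat 1 $ i $ j] (mod 2))}\<rparr>"


section \<open>The cocycle\<close>

definition hilbert_real :: "real \<Rightarrow> real \<Rightarrow> int" where
  "hilbert_real a b = (if a < 0 \<and> b < 0 then -1 else 1)"

text \<open>
  A representative of the square class \<open>x(g)\<close>. The real Hilbert symbol depends only on the signs
  of its arguments, so the choice of representative does not matter.
\<close>

definition x_rep :: "real^2^2 \<Rightarrow> real" where
  "x_rep g = (if g $ 2 $ 1 = 0 then g $ 2 $ 2 else g $ 2 $ 1)"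

definition c_bar :: "real^2^2 \<Rightarrow> real^2^2 \<Rightarrow> int" where
  "c_bar g1 g2 =
     hilbert_real (x_rep g1) (x_rep g2) * hilbert_real (- x_rep g1 * x_rep g2) (x_rep (g1 ** g2))"

definition diag1 :: "real \<Rightarrow> real^2^2" where
  "diag1 y = vector [vector [1, 0], vector [0, y]]"

definition twist :: "real^2^2 \<Rightarrow> real \<Rightarrow> real^2^2" where
  "twist g y = matrix_inv (diag1 y) ** g ** diag1 y"

definition nu2 :: "real \<Rightarrow> real^2^2 \<Rightarrow> int" where
  "nu2 y g = (if g $ 2 $ 1 = 0 then hilbert_real y (g $ 1 $ 1) else 1)"

text \<open>The factor \<open>g\<close> in the decomposition \<open>h = diag1 (det h) ** g\<close>, where \<open>det g = 1\<close>.\<close>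

definition sl_part :: "real^2^2 \<Rightarrow> real^2^2" where
  "sl_part h = matrix_inv (diag1 (det h)) ** h"

definition C_bar :: "real^2^2 \<Rightarrow> real^2^2 \<Rightarrow> complex" where
  "C_bar h1 h2 =
     of_int (nu2 (det h2) (sl_part h1) * c_bar (twist (sl_part h1) (det h2)) (sl_part h2))"

end

theory Submission
  imports Defs
begin

text \<open>
  The class is nontrivial because \<open>Gamma2pm\<close> contains two commuting elements on which the cocycle
  is not symmetric. Since the circle group is abelian, a coboundary takes the same value on
  \<open>(g, h)\<close> and \<open>(h, g)\<close> whenever \<open>g\<close> and \<open>h\<close> commute (\<open>coboundary2_commute\<close>). For \<open>-I\<close> and
  \<open>diag(1, -1)\<close> the two values are \<open>-1\<close> and \<open>1\<close>: the factor \<open>nu2\<close> contributes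
  \<open>(-1, -1) = -1\<close> in the one order and nothing in the other (\<open>C_bar_asymmetric\<close>).

  The class is an element of the cohomology group only because \<open>C_bar\<close> satisfies the cocycle
  identity, and most of the work goes into this. All Hilbert symbols are symbols of signs, and for
  determinant 1 one finds \<open>c_bar g h = -1\<close> exactly when \<open>x(g)\<close> and \<open>x(h)\<close> have the same sign and
  \<open>x(gh)\<close> has the other (\<open>c_bar_signs\<close>). Expanding the cocycle identity for \<open>c_bar\<close> in the signs of
  the six numbers involved, one sees that it fails if and only if
  \<open>x(gh) x(hk)\<close>, \<open>- x(h) x(ghk)\<close> and \<open>- x(g) x(k)\<close> all have the same sign. Now \<open>x(g)\<close> is the
  first nonzero entry of the lower row \<open>r(g)\<close> of \<open>g\<close>, so its sign is the sign of \<open>r(g)\<close> in the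
  lexicographic order of the plane, and if \<open>c(g)\<close> is the first entry of \<open>r(g)\<close>, then
  \[ c(gh) r(hk) = c(h) r(ghk) + c(g) r(k). \]
  When the three coefficients are nonzero, they are \<open>x(gh)\<close>, \<open>x(h)\<close>, \<open>x(g)\<close>, and three vectors
  of the same lexicographic sign cannot have sum 0; the degenerate cases are direct
  (\<open>x_rep_signs\<close>).

  The passage to determinant \<open>-1\<close> is that of a semidirect product. Conjugation by \<open>diag(1, y)\<close>
  changes \<open>c_bar\<close> by the coboundary of \<open>nu2 y\<close> (\<open>c_bar_twist\<close>), and \<open>nu2\<close> is a crossed
  homomorphism in \<open>y\<close> (\<open>nu2_mult\<close>); these two rules turn the cocycle identity of \<open>c_bar\<close> into
  that of \<open>C_bar\<close>.
\<close>

section \<open>Lexicographic signs of row vectors\<close>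

text \<open>
  The first nonzero entry of the row \<open>(c, d)\<close>; it is positive if and only if the row is positive
  in the lexicographic order.
\<close>

definition lex_sign :: "real \<Rightarrow> real \<Rightarrow> real" where
  "lex_sign c d = (if c = 0 then d else c)"

lemma lex_sign_scale: "t \<noteq> 0 \<Longrightarrow> lex_sign (t * c) (t * d) = t * lex_sign c d"
  by (simp add: lex_sign_def)

lemma lex_sign_neg_add:
  "lex_sign c d < 0 \<Longrightarrow> lex_sign c' d' < 0 \<Longrightarrow> lex_sign (c + c') (d + d') < 0"
  by (auto simp: lex_sign_def split: if_splits)

lemma lex_sign_pos_add:
  "lex_sign c d > 0 \<Longrightarrow> lex_sign c' d' > 0 \<Longrightarrow> lex_sign (c + c') (d + d') > 0"
  by (auto simp: lex_sign_def split: if_splits)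

text \<open>
  The lexicographically positive vectors are a convex cone, and so are the negative ones; hence
  the two sides of a linear relation cannot have opposite signs.
\<close>

lemma lex_sign_relation:
  fixes p q r :: real
  assumes "p \<noteq> 0" "q \<noteq> 0" "r \<noteq> 0"
    and "p * c1 = q * c2 + r * c3" "p * d1 = q * d2 + r * d3"
  shows "\<not> (q * lex_sign c2 d2 < 0 \<and> r * lex_sign c3 d3 < 0 \<and> p * lex_sign c1 d1 > 0)"
    and "\<not> (q * lex_sign c2 d2 > 0 \<and> r * lex_sign c3 d3 > 0 \<and> p * lex_sign c1 d1 < 0)"
proof -
  have "p * lex_sign c1 d1 = lex_sign (q * c2 + r * c3) (q * d2 + r * d3)"
    unfolding lex_sign_scale[OF assms(1), symmetric] assms(4,5) ..
  then show "\<not> (q * lex_sign c2 d2 < 0 \<and> r * lex_sign c3 d3 < 0 \<and> p * lex_sign c1 d1 > 0)"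
    and "\<not> (q * lex_sign c2 d2 > 0 \<and> r * lex_sign c3 d3 > 0 \<and> p * lex_sign c1 d1 < 0)"
    using lex_sign_neg_add[of "q * c2" "q * d2" "r * c3" "r * d3"]
      lex_sign_pos_add[of "q * c2" "q * d2" "r * c3" "r * d3"]
    unfolding lex_sign_scale[OF assms(2)] lex_sign_scale[OF assms(3)] by linarith+
qed

section \<open>Two by two matrices and the decomposition of determinant \<open>\<plusminus>1\<close>\<close>

lemma mat2_mult_nth:
  fixes A B :: "'a::semiring_1^2^2"
  shows "(A ** B) $ i $ j = A $ i $ 1 * B $ 1 $ j + A $ i $ 2 * B $ 2 $ j"
  by (simp add: matrix_matrix_mult_def sum_2)

lemma mat2_eq_iff:
  fixes A B :: "'a^2^2"
  shows "A = B \<longleftrightarrow> A$1$1 = B$1$1 \<and> A$1$2 = B$1$2 \<and> A$2$1 = B$2$1 \<and> A$2$2 = B$2$2"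
  by (auto simp: vec_eq_iff forall_2)

lemma mat_nth: "mat k $ i $ j = (if i = j then k else 0)"
  by (simp add: mat_def)

lemma diag1_nth [simp]:
  "diag1 y $ 1 $ 1 = 1" "diag1 y $ 1 $ 2 = 0" "diag1 y $ 2 $ 1 = 0" "diag1 y $ 2 $ 2 = y"
  by (simp_all add: diag1_def)

lemma matrix_inv_diag1:
  assumes "y = 1 \<or> y = -1"
  shows "matrix_inv (diag1 y) = diag1 y"
proof -
  have inv: "diag1 y ** diag1 y = mat 1"
    using assms by (auto simp: mat2_eq_iff mat2_mult_nth mat_nth)
  have "diag1 y ** matrix_inv (diag1 y) = mat 1"
    unfolding matrix_inv_def by (rule someI2[where a = "diag1 y"]) (simp_all add: inv)
  then have "diag1 y ** (diag1 y ** matrix_inv (diag1 y)) = diag1 y" by simp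
  then show ?thesis by (simp add: matrix_mul_assoc inv)
qed

lemma twist_nth:
  assumes "y = 1 \<or> y = -1"
  shows "twist g y $ 1 $ 1 = g $ 1 $ 1" "twist g y $ 1 $ 2 = y * g $ 1 $ 2"
    "twist g y $ 2 $ 1 = y * g $ 2 $ 1" "twist g y $ 2 $ 2 = g $ 2 $ 2"
  using assms by (auto simp: twist_def matrix_inv_diag1 mat2_mult_nth)

lemma twist_mult:
  assumes "y = 1 \<or> y = -1"
  shows "twist (g ** h) y = twist g y ** twist h y"
  using assms by (auto simp: mat2_eq_iff mat2_mult_nth twist_nth)

lemma twist_twist:
  assumes "y = 1 \<or> y = -1" "z = 1 \<or> z = -1"
  shows "twist (twist g y) z = twist g (y * z)"
  using assms by (auto simp: mat2_eq_iff twist_nth)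

lemma det_twist: "y = 1 \<or> y = -1 \<Longrightarrow> det (twist g y) = det g"
  by (auto simp: det_2 twist_nth)

lemma twist_1: "twist g 1 = g"
  by (simp add: mat2_eq_iff twist_nth)

lemma sl_part_nth:
  assumes "det h = 1 \<or> det h = -1"
  shows "sl_part h $ 1 $ j = h $ 1 $ j" "sl_part h $ 2 $ j = det h * h $ 2 $ j"
  using assms by (auto simp: sl_part_def matrix_inv_diag1 mat2_mult_nth)

lemma det_sl_part:
  assumes "det h = 1 \<or> det h = -1"
  shows "det (sl_part h) = 1"
proof -
  have "det (sl_part h) = det h * det h"
    using assms by (simp add: det_2[of "sl_part h"] sl_part_nth) (simp add: det_2 algebra_simps)
  then show ?thesis using assms by auto
qed

text \<open>
  Moving \<open>diag1 (det h2)\<close> to the left past \<open>sl_part h1\<close> conjugates the latter: this is the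
  multiplication of the semidirect product of \<open>SL2\<close> by \<open>{1, -1}\<close>.
\<close>

lemma sl_part_mult:
  assumes "det h1 = 1 \<or> det h1 = -1" "det h2 = 1 \<or> det h2 = -1"
  shows "sl_part (h1 ** h2) = twist (sl_part h1) (det h2) ** sl_part h2"
proof -
  have "det (h1 ** h2) = 1 \<or> det (h1 ** h2) = -1"
    using assms by (auto simp: det_mul)
  then show ?thesis
    using assms
    by (auto simp: mat2_eq_iff mat2_mult_nth sl_part_nth twist_nth det_mul algebra_simps)
qed

section \<open>The cocycle identity in determinant 1\<close>

lemma x_rep_eq_lex_sign: "x_rep g = lex_sign (g $ 2 $ 1) (g $ 2 $ 2)"
  by (simp add: x_rep_def lex_sign_def)

lemma x_rep_nonzero: "det g = 1 \<Longrightarrow> x_rep g \<noteq> 0"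
  by (auto simp: x_rep_def det_2)

lemma c_bar_signs:
  assumes "det g = 1" "det h = 1"
  shows "c_bar g h = (if (x_rep g < 0 \<longleftrightarrow> x_rep h < 0) \<and> (x_rep (g ** h) < 0 \<longleftrightarrow> \<not> x_rep g < 0)
    then -1 else 1)"
  using x_rep_nonzero[OF assms(1)] x_rep_nonzero[OF assms(2)]
    x_rep_nonzero[of "g ** h"] assms
  by (auto simp: c_bar_def hilbert_real_def det_mul mult_less_0_iff not_less
      zero_le_mult_iff zero_less_mult_iff)

text \<open>
  With \<open>u = (0, 1)\<close>, the three lower rows on both sides are the images under \<open>k\<close> of the plane
  vectors \<open>u h\<close>, \<open>u g h\<close> and \<open>u\<close>. The formula is the linear relation between these vectors, whose
  coefficients are, up to sign, their pairwise determinants: that of \<open>u h\<close> and \<open>u g h = (u g) h\<close> is the one of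
  \<open>u\<close> and \<open>u g\<close>, because \<open>h\<close> has determinant 1.
\<close>

lemma lower_row_relation:
  fixes g h k :: "real^2^2"
  assumes "det h = 1"
  shows "(g ** h) $ 2 $ 1 * (h ** k) $ 2 $ j
    = h $ 2 $ 1 * (g ** h ** k) $ 2 $ j + g $ 2 $ 1 * k $ 2 $ j"
proof -
  have "(g ** h) $ 2 $ 1 * (h ** k) $ 2 $ j
    = h $ 2 $ 1 * (g ** h ** k) $ 2 $ j + det h * (g $ 2 $ 1 * k $ 2 $ j)"
    by (simp add: mat2_mult_nth det_2 algebra_simps)
  then show ?thesis using assms by simp
qed

text \<open>
  The coefficients of the relation of lower rows are \<open>x(gh)\<close>, \<open>x(h)\<close> and \<open>x(g)\<close> except at
  upper triangular matrices, where the coefficient is 0 and the relation says nothing about the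
  sign of \<open>x\<close>. The following three lemmas determine it when \<open>g\<close>, \<open>h\<close> or \<open>g ** h\<close> is upper
  triangular.
\<close>

lemma x_rep_mult_upper_left:
  assumes "det g = 1" "g $ 2 $ 1 = 0"
  shows "x_rep (g ** h) = x_rep g * x_rep h"
proof -
  have "g $ 2 $ 2 \<noteq> 0" using assms by (auto simp: det_2)
  then show ?thesis
    using assms by (simp add: x_rep_def mat2_mult_nth)
qed

lemma x_rep_mult_upper_right:
  assumes "det h = 1" "h $ 2 $ 1 = 0"
  shows "x_rep (g ** h) < 0 \<longleftrightarrow> x_rep g * x_rep h < 0"
proof -
  have "h $ 1 $ 1 * h $ 2 $ 2 > 0" using assms by (simp add: det_2)
  then have "h $ 1 $ 1 \<noteq> 0" "h $ 1 $ 1 < 0 \<longleftrightarrow> h $ 2 $ 2 < 0" "h $ 1 $ 1 > 0 \<longleftrightarrow> h $ 2 $ 2 > 0"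
    by (auto simp: zero_less_mult_iff)
  then show ?thesis
    using assms by (simp add: x_rep_def mat2_mult_nth mult_less_0_iff)
qed

lemma x_rep_mult_upper_product:
  assumes "det h = 1" "(g ** h) $ 2 $ 1 = 0"
  shows "g $ 2 $ 1 = - (h $ 2 $ 1 * x_rep (g ** h))"
proof -
  have "h $ 2 $ 1 * (g ** h) $ 2 $ 2 - h $ 2 $ 2 * (g ** h) $ 2 $ 1 = - (det h * g $ 2 $ 1)"
    by (simp add: mat2_mult_nth det_2 algebra_simps)
  then show ?thesis using assms by (simp add: x_rep_def)
qed

text \<open>
  The two equivalences say that \<open>x(gh) x(hk)\<close>, \<open>- x(h) x(ghk)\<close> and \<open>- x(g) x(k)\<close> have the same
  sign. If no coefficient of the relation of lower rows vanishes, these are the signs of the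
  three vectors in a relation with sum 0, which cannot agree.
\<close>

lemma x_rep_signs:
  fixes g h k :: "real^2^2"
  assumes "det g = 1" "det h = 1" "det k = 1"
  shows "\<not> (((x_rep (g ** h) < 0 \<longleftrightarrow> x_rep (h ** k) < 0) \<longleftrightarrow> \<not> (x_rep h < 0 \<longleftrightarrow> x_rep (g ** h ** k) < 0))
    \<and> ((x_rep (g ** h) < 0 \<longleftrightarrow> x_rep (h ** k) < 0) \<longleftrightarrow> \<not> (x_rep g < 0 \<longleftrightarrow> x_rep k < 0)))"
proof -
  have dets: "det (g ** h) = 1" "det (h ** k) = 1" "det (g ** h ** k) = 1"
    using assms by (simp_all add: det_mul)
  note nz = assms[THEN x_rep_nonzero] dets[THEN x_rep_nonzero]
  have neg_iff: "x * y < 0 \<longleftrightarrow> (x < 0 \<longleftrightarrow> \<not> y < 0)" and pos_iff: "x * y > 0 \<longleftrightarrow> (x < 0 \<longleftrightarrow> y < 0)"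
    if "x \<noteq> 0" "y \<noteq> 0" for x y :: real
    using that by (auto simp: mult_less_0_iff zero_less_mult_iff)
  consider "g $ 2 $ 1 = 0" | "h $ 2 $ 1 = 0"
    | "(g ** h) $ 2 $ 1 = 0" "g $ 2 $ 1 \<noteq> 0" "h $ 2 $ 1 \<noteq> 0"
    | "(g ** h) $ 2 $ 1 \<noteq> 0" "g $ 2 $ 1 \<noteq> 0" "h $ 2 $ 1 \<noteq> 0"
    by blast
  then show ?thesis
  proof cases
    case 1
    have "x_rep (g ** h) = x_rep g * x_rep h" "x_rep (g ** h ** k) = x_rep g * x_rep (h ** k)"
      using x_rep_mult_upper_left[OF assms(1) 1] by (simp_all flip: matrix_mul_assoc)
    then show ?thesis by (simp only: neg_iff nz not_False_eq_True) blast
  next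
    case 2
    have "x_rep (g ** h) < 0 \<longleftrightarrow> x_rep g * x_rep h < 0" "x_rep (h ** k) = x_rep h * x_rep k"
      using x_rep_mult_upper_left[OF assms(2) 2] x_rep_mult_upper_right[OF assms(2) 2] by simp_all
    then show ?thesis by (simp only: neg_iff nz not_False_eq_True) blast
  next
    case 3
    have "x_rep (g ** h ** k) = x_rep (g ** h) * x_rep k"
      using x_rep_mult_upper_left[OF dets(1) 3(1)] .
    moreover have "x_rep g = - (x_rep h * x_rep (g ** h))"
      using x_rep_mult_upper_product[OF assms(2) 3(1)] 3 by (simp add: x_rep_def)
    ultimately show ?thesis by (simp only: neg_iff pos_iff neg_less_0_iff_less nz not_False_eq_True) blast
  next
    case 4
    note rel = lex_sign_relation[OF 4(1,3,2) lower_row_relation lower_row_relation, OF assms(2,2)]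
    have "\<not> (x_rep h * x_rep (g ** h ** k) < 0 \<and> x_rep g * x_rep k < 0 \<and> x_rep (g ** h) * x_rep (h ** k) > 0)"
      "\<not> (x_rep h * x_rep (g ** h ** k) > 0 \<and> x_rep g * x_rep k > 0 \<and> x_rep (g ** h) * x_rep (h ** k) < 0)"
      using rel[of k] 4 by (simp_all add: x_rep_eq_lex_sign lex_sign_def)
    then show ?thesis by (simp only: neg_iff pos_iff nz not_False_eq_True) blast
  qed
qed

text \<open>
  As an identity between signs, the cocycle condition is equivalent to the configuration of
  signs just excluded not occurring.
\<close>

lemma c_bar_cocycle:
  assumes "det g = 1" "det h = 1" "det k = 1"
  shows "c_bar g h * c_bar (g ** h) k = c_bar h k * c_bar g (h ** k)"
proof -
  \<comment> \<open>The truth values stand for the negativity of \<open>x\<close> at the products indicated by the indices.\<close>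
  have sign_identity: "(if (e1 \<longleftrightarrow> e2) \<and> (e12 \<longleftrightarrow> \<not> e1) then -1 else 1) *
      (if (e12 \<longleftrightarrow> e3) \<and> (e123 \<longleftrightarrow> \<not> e12) then -1 else 1) =
      (if (e2 \<longleftrightarrow> e3) \<and> (e23 \<longleftrightarrow> \<not> e2) then -1 else 1) *
      (if (e1 \<longleftrightarrow> e23) \<and> (e123 \<longleftrightarrow> \<not> e1) then -1 else 1 :: int)"
    if "\<not> (((e12 \<longleftrightarrow> e23) \<longleftrightarrow> \<not> (e2 \<longleftrightarrow> e123)) \<and> ((e12 \<longleftrightarrow> e23) \<longleftrightarrow> \<not> (e1 \<longleftrightarrow> e3)))"
    for e1 e2 e3 e12 e23 e123
    using that by (cases e1; cases e2; cases e3; cases e12; cases e23; simp)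
  show ?thesis
    using sign_identity[OF x_rep_signs[OF assms]] assms
    by (simp only: c_bar_signs det_mul matrix_mul_assoc mult_1_left)
qed

section \<open>Conjugation by \<open>diag(1, y)\<close>\<close>

lemma nu2_signs:
  assumes "det g = 1"
  shows "nu2 (-1) g = (if g $ 2 $ 1 = 0 \<and> x_rep g < 0 then -1 else 1)"
proof -
  have "g $ 1 $ 1 < 0 \<longleftrightarrow> g $ 2 $ 2 < 0" if "g $ 2 $ 1 = 0"
  proof -
    have "g $ 1 $ 1 * g $ 2 $ 2 > 0" using assms that by (auto simp: det_2)
    then show ?thesis by (auto simp: zero_less_mult_iff)
  qed
  then show ?thesis by (auto simp: nu2_def hilbert_real_def x_rep_def)
qed

lemma nu2_1: "nu2 1 g = 1"
  by (simp add: nu2_def hilbert_real_def)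

text \<open>
  The twist changes neither the upper left entry nor the vanishing of the lower left one, and
  \<open>nu2\<close> depends on nothing else of the matrix. So the crossed homomorphism property reduces to the multiplicativity of the Hilbert symbol.
\<close>

lemma nu2_mult:
  assumes "y = 1 \<or> y = -1" "z = 1 \<or> z = -1"
  shows "nu2 (y * z) g = nu2 y g * nu2 z (twist g y)"
  using assms by (auto simp: nu2_def hilbert_real_def twist_nth)

lemma x_rep_twist:
  "x_rep (twist g (-1)) = (if g $ 2 $ 1 = 0 then x_rep g else - x_rep g)"
  by (simp add: x_rep_def twist_nth)

text \<open>
  Conjugation by \<open>diag(1, -1)\<close> reverses the sign of \<open>x(g)\<close> unless \<open>g\<close> is upper triangular. If
  none of \<open>g\<close>, \<open>h\<close>, \<open>gh\<close> is, all three signs are reversed and \<open>c_bar\<close> is unchanged; otherwise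
  the signs that stay produce the values of \<open>nu2 (-1)\<close>, which on an upper triangular matrix is the
  sign of its diagonal entries.
\<close>

lemma c_bar_twist:
  assumes "y = 1 \<or> y = -1" "det g = 1" "det h = 1"
  shows "c_bar g h * nu2 y (g ** h) = nu2 y g * nu2 y h * c_bar (twist g y) (twist h y)"
proof (cases "y = 1")
  case False
  then have y: "y = -1" using assms by simp
  have d: "det (g ** h) = 1" using assms by (simp add: det_mul)
  note nz = assms(2,3)[THEN x_rep_nonzero] d[THEN x_rep_nonzero]
  have tw: "twist g (-1) ** twist h (-1) = twist (g ** h) (-1)"
    by (simp add: twist_mult)
  note [simp] = c_bar_signs det_twist x_rep_twist nu2_signs tw y assms(2,3) d
  consider "g $ 2 $ 1 = 0" | "h $ 2 $ 1 = 0" "g $ 2 $ 1 \<noteq> 0"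
    | "(g ** h) $ 2 $ 1 = 0" "g $ 2 $ 1 \<noteq> 0" "h $ 2 $ 1 \<noteq> 0"
    | "(g ** h) $ 2 $ 1 \<noteq> 0" "g $ 2 $ 1 \<noteq> 0" "h $ 2 $ 1 \<noteq> 0"
    by blast
  then show ?thesis
  proof cases
    case 1
    have "g $ 2 $ 2 \<noteq> 0" using assms(2) 1 by (auto simp: det_2)
    then have "(g ** h) $ 2 $ 1 = 0 \<longleftrightarrow> h $ 2 $ 1 = 0" using 1 by (simp add: mat2_mult_nth)
    then show ?thesis
      using nz 1 x_rep_mult_upper_left[OF assms(2) 1, of h] by (auto simp: mult_less_0_iff zero_less_mult_iff)
  next
    case 2
    have "h $ 1 $ 1 \<noteq> 0" using assms(3) 2 by (auto simp: det_2)
    then have "(g ** h) $ 2 $ 1 \<noteq> 0" using 2 by (simp add: mat2_mult_nth)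
    then show ?thesis
      using nz 2 x_rep_mult_upper_right[OF assms(3) 2(1), of g] by (auto simp: mult_less_0_iff)
  next
    case 3
    have "x_rep g = - (x_rep h * x_rep (g ** h))"
      using x_rep_mult_upper_product[OF assms(3) 3(1)] 3 by (simp add: x_rep_def)
    then show ?thesis using nz 3 by (auto simp: mult_less_0_iff zero_less_mult_iff)
  next
    case 4
    then show ?thesis using nz by (auto simp: mult_less_0_iff)
  qed
qed (simp add: nu2_1 twist_1)

section \<open>The cocycle identity in determinant \<open>\<plusminus>1\<close>\<close>

lemma C_bar_cocycle:
  assumes "det h1 = 1 \<or> det h1 = -1" "det h2 = 1 \<or> det h2 = -1" "det h3 = 1 \<or> det h3 = -1"
  shows "C_bar h1 h2 * C_bar (h1 ** h2) h3 = C_bar h2 h3 * C_bar h1 (h2 ** h3)"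
proof -
  define y2 y3 where y: "y2 = det h2" "y3 = det h3"
  define k g2 g3 where g: "k = twist (sl_part h1) y2" "g2 = sl_part h2" "g3 = sl_part h3"
  have dets: "det k = 1" "det g2 = 1" "det g3 = 1" and ys: "y2 = 1 \<or> y2 = -1" "y3 = 1 \<or> y3 = -1"
    using assms by (auto simp: g y det_twist det_sl_part)
  \<comment> \<open>\<open>c_bar_twist\<close> expresses \<open>c_bar k g2\<close> by the conjugates of \<open>k\<close> and \<open>g2\<close> under \<open>y3\<close>, which are
    the matrices that get multiplied with \<open>g3\<close>; then the cocycle identity of \<open>c_bar\<close> applies.\<close>
  have "nu2 y2 (sl_part h1) * c_bar k g2 * (nu2 y3 (k ** g2) * c_bar (twist (k ** g2) y3) g3)
      = nu2 y2 (sl_part h1) * (c_bar k g2 * nu2 y3 (k ** g2)) * c_bar (twist k y3 ** twist g2 y3) g3"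
    by (simp add: twist_mult[OF ys(2)])
  also have "\<dots> = nu2 y2 (sl_part h1) * nu2 y3 k * nu2 y3 g2
      * (c_bar (twist k y3) (twist g2 y3) * c_bar (twist k y3 ** twist g2 y3) g3)"
    by (simp add: c_bar_twist[OF ys(2) dets(1,2)])
  also have "\<dots> = nu2 y3 g2 * c_bar (twist g2 y3) g3
      * (nu2 (y2 * y3) (sl_part h1) * c_bar (twist k y3) (twist g2 y3 ** g3))"
    using dets ys by (simp add: c_bar_cocycle det_twist nu2_mult[OF ys] g(1))
  finally have "nu2 y2 (sl_part h1) * c_bar k g2 * (nu2 y3 (k ** g2) * c_bar (twist (k ** g2) y3) g3)
      = nu2 y3 g2 * c_bar (twist g2 y3) g3
      * (nu2 (y2 * y3) (sl_part h1) * c_bar (twist k y3) (twist g2 y3 ** g3))" .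
  moreover have "C_bar h1 h2 = of_int (nu2 y2 (sl_part h1) * c_bar k g2)"
    "C_bar h2 h3 = of_int (nu2 y3 g2 * c_bar (twist g2 y3) g3)"
    by (simp_all only: C_bar_def y g)
  moreover have "C_bar (h1 ** h2) h3 = of_int (nu2 y3 (k ** g2) * c_bar (twist (k ** g2) y3) g3)"
    by (simp only: C_bar_def y g sl_part_mult[OF assms(1,2)])
  moreover have "twist k y3 = twist (sl_part h1) (y2 * y3)"
    by (simp only: g twist_twist[OF ys])
  then have "C_bar h1 (h2 ** h3)
      = of_int (nu2 (y2 * y3) (sl_part h1) * c_bar (twist k y3) (twist g2 y3 ** g3))"
    by (simp only: C_bar_def y g sl_part_mult[OF assms(2,3)] det_mul)
  ultimately show ?thesis
    by (metis of_int_mult)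
qed

lemma norm_C_bar: "cmod (C_bar h1 h2) = 1"
  by (auto simp: C_bar_def nu2_def c_bar_def hilbert_real_def)

section \<open>Circle-valued coboundaries\<close>

lemma carrier_circle_group: "carrier circle_group = {z. cmod z = 1}"
  and circle_group_mult: "x \<otimes>\<^bsub>circle_group\<^esub> y = x * y"
  by (simp_all add: circle_group_def)

lemma circle_group_inv:
  assumes "cmod z = 1" shows "inv\<^bsub>circle_group\<^esub> z = inverse z"
proof -
  interpret comm_group circle_group
    by (rule comm_groupI)
      (auto simp: circle_group_def norm_mult mult_ac norm_inverse
        intro!: exI[of _ "inverse _"] right_inverse)
  show ?thesis
    by (rule inv_equality)
      (use assms in \<open>auto simp: circle_group_def norm_inverse intro!: left_inverse\<close>)
qed

lemma coboundary2_commute: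
  assumes "f \<in> coboundaries2 G circle_group"
    and "g \<in> carrier G" "h \<in> carrier G" "g \<otimes>\<^bsub>G\<^esub> h = h \<otimes>\<^bsub>G\<^esub> g"
  shows "f (g, h) = f (h, g)"
  using assms by (auto simp: coboundaries2_def circle_group_mult mult.commute)

text \<open>
  The identity element of the quotient is the set of coboundaries itself, and a coset contains its
  representative because the constant cochain 1 is a coboundary. The closure of \<open>G\<close> makes
  \<open>\<phi> (g \<otimes> h)\<close> equal to 1 for the extensional constant \<open>\<phi> = 1\<close>.
\<close>

lemma trivial_class2_imp_coboundary:
  assumes "\<And>g h. g \<in> carrier G \<Longrightarrow> h \<in> carrier G \<Longrightarrow> g \<otimes>\<^bsub>G\<^esub> h \<in> carrier G"
    and "cohomology_class2 G circle_group f = \<one>\<^bsub>cohomology2 G circle_group\<^esub>"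
  shows "(\<lambda>(g, h)\<in>carrier G \<times> carrier G. f g h) \<in> coboundaries2 G circle_group"
proof -
  let ?f = "\<lambda>(g, h)\<in>carrier G \<times> carrier G. f g h"
  let ?u = "\<lambda>p\<in>carrier G \<times> carrier G. (1::complex)"
  have "?u \<in> coboundaries2 G circle_group"
    unfolding coboundaries2_def
    by (rule image_eqI[of _ _ "\<lambda>g\<in>carrier G. 1"])
       (auto simp: carrier_circle_group circle_group_mult circle_group_inv assms(1) fun_eq_iff)
  then have "?u \<otimes>\<^bsub>cocycle_group2 G circle_group\<^esub> ?f \<in> cohomology_class2 G circle_group f"
    unfolding cohomology_class2_def r_coset_def by blast
  moreover have "?u \<otimes>\<^bsub>cocycle_group2 G circle_group\<^esub> ?f = ?f"
    by (auto simp: cocycle_group2_def circle_group_mult fun_eq_iff)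
  ultimately show ?thesis
    using assms(2) by (simp add: cohomology2_def FactGroup_def)
qed

section \<open>Restriction to \<open>Gamma2pm\<close>\<close>

lemma Gamma2pm_mult: "g \<otimes>\<^bsub>Gamma2pm\<^esub> h = g ** h"
  by (simp add: Gamma2pm_def SL2pm_def)

lemma carrier_Gamma2pm: "carrier Gamma2pm = map_matrix real_of_int `
       {g :: int^2^2. (det g = 1 \<or> det g = -1) \<and> (\<forall>i j. [g $ i $ j = mat 1 $ i $ j] (mod 2))}"
  by (simp add: Gamma2pm_def)

lemma det_Gamma2pm:
  assumes "g \<in> carrier Gamma2pm"
  shows "det g = 1 \<or> det g = -1"
proof -
  have "det (map_matrix real_of_int A) = of_int (det A)" for A :: "int^2^2"
    by (simp add: det_2)
  with assms show ?thesis by (auto simp: carrier_Gamma2pm)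
qed

lemma Gamma2pm_closed:
  assumes "g \<in> carrier Gamma2pm" "h \<in> carrier Gamma2pm"
  shows "g ** h \<in> carrier Gamma2pm"
proof -
  obtain A B :: "int^2^2" where A: "g = map_matrix real_of_int A" "det A = 1 \<or> det A = -1"
      "\<And>i j. [A $ i $ j = mat 1 $ i $ j] (mod 2)"
    and B: "h = map_matrix real_of_int B" "det B = 1 \<or> det B = -1"
      "\<And>i j. [B $ i $ j = mat 1 $ i $ j] (mod 2)"
    using assms by (auto simp: carrier_Gamma2pm)
  have "g ** h = map_matrix real_of_int (A ** B)"
    by (simp add: A B mat2_eq_iff mat2_mult_nth)
  moreover have "det (A ** B) = 1 \<or> det (A ** B) = -1"
    using A B by (auto simp: det_mul)
  moreover have "[(A ** B) $ i $ j = (mat 1 ** mat 1) $ i $ j] (mod 2)" for i j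
    unfolding mat2_mult_nth by (intro cong_add cong_mult A B)
  ultimately show ?thesis unfolding carrier_Gamma2pm by auto
qed

lemma C_bar_in_cocycles2:
  "(\<lambda>(g, h)\<in>carrier Gamma2pm \<times> carrier Gamma2pm. C_bar g h) \<in> cocycles2 Gamma2pm circle_group"
  by (auto simp: cocycles2_def Gamma2pm_mult Gamma2pm_closed carrier_circle_group circle_group_mult
      norm_C_bar C_bar_cocycle det_Gamma2pm)

lemma diag_in_Gamma2pm:
  "- mat 1 \<in> carrier Gamma2pm" "diag1 (-1) \<in> carrier Gamma2pm"
proof -
  have "(- mat 1 :: real^2^2) = map_matrix real_of_int (- mat 1)"
    by (simp add: mat2_eq_iff mat_nth)
  then show "- mat 1 \<in> carrier Gamma2pm"
    unfolding carrier_Gamma2pm by (auto intro!: image_eqI simp: det_2 mat_nth cong_def)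
next
  let ?A = "vector [vector [1, 0], vector [0, -1]] :: int^2^2"
  have "diag1 (-1) = map_matrix real_of_int ?A"
    by (simp add: mat2_eq_iff)
  moreover have "\<forall>i j. [?A $ i $ j = mat 1 $ i $ j] (mod 2)"
    by (simp add: forall_2 mat_nth cong_def)
  ultimately show "diag1 (-1) \<in> carrier Gamma2pm"
    unfolding carrier_Gamma2pm by (auto intro!: image_eqI simp: det_2)
qed

lemma C_bar_asymmetric:
  "C_bar (- mat 1) (diag1 (-1)) = -1" "C_bar (diag1 (-1)) (- mat 1) = 1"
proof -
  have d: "det (- mat 1 :: real^2^2) = 1" "det (diag1 (-1)) = -1"
    by (simp_all add: det_2 mat_nth)
  have "sl_part (- mat 1) = - mat 1" "sl_part (diag1 (-1)) = mat 1"
    by (simp_all add: mat2_eq_iff sl_part_nth d) (simp_all add: mat_nth)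
  moreover have "twist (- mat 1) (-1) = - mat 1"
    by (simp add: mat2_eq_iff twist_nth mat_nth)
  ultimately show "C_bar (- mat 1) (diag1 (-1)) = -1" "C_bar (diag1 (-1)) (- mat 1) = 1"
    by (simp_all add: C_bar_def d twist_1 nu2_1 nu2_def c_bar_def x_rep_def hilbert_real_def mat_nth)
qed

theorem lemma6p9:
  shows "cohomology_class2 Gamma2pm circle_group C_bar \<in> carrier (cohomology2 Gamma2pm circle_group)
       \<and> cohomology_class2 Gamma2pm circle_group C_bar \<noteq> \<one>\<^bsub>cohomology2 Gamma2pm circle_group\<^esub>"
proof
  show "cohomology_class2 Gamma2pm circle_group C_bar \<in> carrier (cohomology2 Gamma2pm circle_group)"
    using C_bar_in_cocycles2
    by (auto simp: cohomology_class2_def cohomology2_def FactGroup_def RCOSETS_def cocycle_group2_def)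
next
  show "cohomology_class2 Gamma2pm circle_group C_bar \<noteq> \<one>\<^bsub>cohomology2 Gamma2pm circle_group\<^esub>"
  proof
    assume "cohomology_class2 Gamma2pm circle_group C_bar = \<one>\<^bsub>cohomology2 Gamma2pm circle_group\<^esub>"
    then have "(\<lambda>(g, h)\<in>carrier Gamma2pm \<times> carrier Gamma2pm. C_bar g h)
        \<in> coboundaries2 Gamma2pm circle_group"
      by (rule trivial_class2_imp_coboundary[rotated]) (simp add: Gamma2pm_mult Gamma2pm_closed)
    moreover have "- mat 1 \<otimes>\<^bsub>Gamma2pm\<^esub> diag1 (-1) = diag1 (-1) \<otimes>\<^bsub>Gamma2pm\<^esub> - mat 1"
      by (simp add: Gamma2pm_mult mat2_eq_iff mat2_mult_nth mat_nth)
    ultimately have "(\<lambda>(g, h)\<in>carrier Gamma2pm \<times> carrier Gamma2pm. C_bar g h) (- mat 1, diag1 (-1))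
        = (\<lambda>(g, h)\<in>carrier Gamma2pm \<times> carrier Gamma2pm. C_bar g h) (diag1 (-1), - mat 1)"
      by (rule coboundary2_commute[OF _ diag_in_Gamma2pm])
    then show False
      by (simp add: diag_in_Gamma2pm C_bar_asymmetric)
  qed
qed

end
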